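(* Let $\{x_k\}_{k\in\mathbb{N}}$ be a sequence generated by Algorithm A (described in the context) from $x_0\in\mathrm{dom}(g)$ with $$H_k=\nabla^2f(x_k)+\big([-\lambda_{\min}(\nabla^2f(x_k))]_++c+\mu_1\min\{1,\|\mathcal{G}(x_k)\|^{\delta}\}\big)I$$ and with $c>\dfrac{\mu_2(1+2L_H+\mu_1)}{2-\mu_2}$, and let $\omega(x_0)$ be its set of cluster points. Suppose that assumptions (i)–(iii) of the context hold and that, for some fixed $q>1$, the following metric $q$-subregularity holds at every $\bar x\in\omega(x_0)$: there exist $\epsilon>0$ and $\kappa>0$ such that $$\mathrm{dist}(x,\mathcal{S}^* )\le\kappa\|\mathcal{G}(x)\|^q\quad\text{for all }x\in\mathbb{B}(\bar x,\epsilon).$$ Then for any $\bar x\in\omega(x_0)$, $\{x_k\}$ converges to $\bar x$ with Q-superlinear convergence rate of order $q$.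
   Context: Problem: minimize $\varphi(x)=f(x)+g(x)$ over $x\in\mathbb{R}^n$; the solution set is assumed nonempty. $\|\cdot\|$ is the Euclidean norm (spectral norm for matrices), $\mathbb{B}(x,r)$ the open Euclidean ball, $\mathrm{dist}$ the Euclidean distance, $\lambda_{\min}$ the smallest eigenvalue, $[a]_+=\max\{0,a\}$. Assumptions. (i) $f:\mathbb{R}^n\to(-\infty,+\infty]$ is twice continuously differentiable on an open set $\Omega_2$ containing $\mathrm{dom}(g)$, $\nabla f$ is $L_H$-Lipschitz continuous on $\Omega_2$, and $\nabla^2f$ is $L_C$-Lipschitz continuous on the open neighborhood of $\omega(x_0)$ of radius $\epsilon_0$, for some $\epsilon_0>0$. (ii) $g:\mathbb{R}^n\to(-\infty,+\infty]$ is proper, closed, convex, nonsmooth (meaning only that differentiability is not assumed) and continuous. (iii) For any $x_0\in\mathrm{dom}(g)$ the level set $\{x:\varphi(x)\le\varphi(x_0)\}$ is bounded. Notation. $\mathrm{prox}_g(u)=\arg\min_x\{g(x)+\frac12\|x-u\|^2\}$. The KKT residual mapping is $\mathcal{G}(x)=x-\mathrm{prox}_g(x-\nabla f(x))$; in the subregularity condition the radius $\epsilon$ is taken small enough that $\mathcal{G}$ is defined on the ball. $\mathcal{S}^*=\{x:0\in\nabla f(x)+\partial g(x)\}$ is the set of stationary points. For a symmetric positive definite matrix $H$, $$q(x;x_k,H)=f(x_k)+\langle\nabla f(x_k),x-x_k\rangle+g(x)+\tfrac12(x-x_k)^\top H(x-x_k)$$ (the function $q(\cdot;\cdot,\cdot)$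 is unrelated to the exponent $q$). Algorithm A (inexact proximal Newton method with backtracking line search). Parameters: $c>0$, $\tau\in(0,c)$, $\mu_1\in(0,1]$, $\mu_2\in(0,\mu_1]$, $\delta\in[0,1]$, $\theta\in(0,1)$ (convention $0^0=1$). For $k=0,1,\dots$: 1. choose $\hat x_k$ and an error vector $\varepsilon_k\in\mathbb{R}^n$ such that $\hat x_k=\arg\min_x\{q(x;x_k,H_k)+\varepsilon_k^\top(x-x_k)\}$ and $\|\varepsilon_k\|\le\frac{\mu_2}{2}\min\{1,\|\mathcal{G}(x_k)\|^{\delta}\}\|\hat x_k-x_k\|$; 2. set $d_k=\hat x_k-x_k$, $\alpha_k=\theta^{j_k}$ and $x_{k+1}=x_k+\alpha_kd_k$, where $j_k$ is the smallest nonnegative integer $j$ with $\varphi(x_k+\theta^{j}d_k)\le\varphi(x_k)-\frac{\tau}{2}\theta^{j}\|d_k\|^2$. The sequence $\{x_k\}$ is the infinite sequence produced without any stopping test. Convergence to $\bar x$ with Q-superlinear rate of order $q$ means: $x_k\to\bar x$ and there is a constant $C$ such that $\|x_{k+1}-\bar x\|\le C\|x_k-\bar x\|^q$ for all sufficiently large $k$. *)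

theory Defs
  imports "HOL-Analysis.Analysis"
begin

section \<open>Extended-real-valued functions\<close>

text \<open>Functions with values in $(-\infty,+\infty]$ are modelled as \<^typ>\<open>ereal\<close>-valued functions;
  that the value $-\infty$ is not attained is stated explicitly where it is needed.\<close>

definition effective_dom :: "('a \<Rightarrow> ereal) \<Rightarrow> 'a set" where
  "effective_dom g = {x. g x < \<infinity>}"

definition proper_fun :: "('a \<Rightarrow> ereal) \<Rightarrow> bool" where
  "proper_fun g \<longleftrightarrow> effective_dom g \<noteq> {} \<and> (\<forall>x. g x \<noteq> -\<infinity>)"

definition ereal_epigraph :: "('a \<Rightarrow> ereal) \<Rightarrow> ('a \<times> real) set" where
  "ereal_epigraph g = {(x, r). g x \<le> ereal r}"

definition closed_fun :: "('a::topological_space \<Rightarrow> ereal) \<Rightarrow> bool" where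
  "closed_fun g \<longleftrightarrow> closed (ereal_epigraph g)"

definition convex_fun :: "('a::real_vector \<Rightarrow> ereal) \<Rightarrow> bool" where
  "convex_fun g \<longleftrightarrow> convex (ereal_epigraph g)"

definition subdifferential :: "('a::real_inner \<Rightarrow> ereal) \<Rightarrow> 'a \<Rightarrow> 'a set" where
  "subdifferential g x =
     {v. x \<in> effective_dom g \<and> (\<forall>y. g x + ereal (v \<bullet> (y - x)) \<le> g y)}"

text \<open>For proper, closed and convex \<open>g\<close> the minimizer exists and is unique, so that the choice made
  by \<^const>\<open>arg_min\<close> is immaterial.\<close>

definition prox :: "('a::real_inner \<Rightarrow> ereal) \<Rightarrow> 'a \<Rightarrow> 'a" where
  "prox g u = arg_min (\<lambda>x. g x + ereal (1/2 * (norm (x - u))\<^sup>2)) (\<lambda>_. True)"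


section \<open>Gradient and Hessian\<close>

text \<open>These are only meaningful at points near which \<open>f\<close> is finite and at which it is
  (twice) differentiable.\<close>

definition grad :: "('a::real_inner \<Rightarrow> ereal) \<Rightarrow> 'a \<Rightarrow> 'a" where
  "grad f x = (THE D. GDERIV (\<lambda>y. real_of_ereal (f y)) x :> D)"

definition hess :: "(real^'n \<Rightarrow> ereal) \<Rightarrow> real^'n \<Rightarrow> real^'n^'n" where
  "hess f x = matrix (frechet_derivative (grad f) (at x))"

definition twice_cont_diff_on :: "(real^'n) set \<Rightarrow> (real^'n \<Rightarrow> ereal) \<Rightarrow> bool" where
  "twice_cont_diff_on \<Omega> f \<longleftrightarrow>
     (\<forall>x\<in>\<Omega>. \<bar>f x\<bar> \<noteq> \<infinity> \<and>
            (\<lambda>y. real_of_ereal (f y)) differentiable (at x) \<and>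
            grad f differentiable (at x)) \<and>
     continuous_on \<Omega> (hess f)"

text \<open>The \<^const>\<open>norm\<close> of the type \<^typ>\<open>real^'n^'n\<close> is the Frobenius norm, hence a separate constant
  for the spectral norm.\<close>

definition spectral_norm :: "real^'n^'n \<Rightarrow> real" where
  "spectral_norm A = onorm ((*v) A)"

definition is_eigenvalue :: "real^'n^'n \<Rightarrow> real \<Rightarrow> bool" where
  "is_eigenvalue A l \<longleftrightarrow> (\<exists>v. v \<noteq> 0 \<and> A *v v = l *\<^sub>R v)"

definition lambda_min :: "real^'n^'n \<Rightarrow> real" where
  "lambda_min A = (LEAST l. is_eigenvalue A l)"


section \<open>The composite problem\<close>

definition kkt_residual :: "('a::real_inner \<Rightarrow> ereal) \<Rightarrow> ('a \<Rightarrow> ereal) \<Rightarrow> 'a \<Rightarrow> 'a" where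
  "kkt_residual f g x = x - prox g (x - grad f x)"

definition stationary_points :: "('a::real_inner \<Rightarrow> ereal) \<Rightarrow> ('a \<Rightarrow> ereal) \<Rightarrow> 'a set" where
  "stationary_points f g = {x. 0 \<in> (\<lambda>v. grad f x + v) ` subdifferential g x}"

definition quad_model ::
  "(real^'n \<Rightarrow> ereal) \<Rightarrow> (real^'n \<Rightarrow> ereal) \<Rightarrow> real^'n \<Rightarrow> real^'n \<Rightarrow> real^'n^'n \<Rightarrow> ereal" where
  "quad_model f g x z H =
     f z + ereal (grad f z \<bullet> (x - z)) + g x + ereal (1/2 * ((x - z) \<bullet> (H *v (x - z))))"

definition cluster_points :: "(nat \<Rightarrow> 'a::topological_space) \<Rightarrow> 'a set" where
  "cluster_points x = {z. \<exists>r. strict_mono r \<and> (x \<circ> r) \<longlonglongrightarrow> z}"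

text \<open>The algorithm uses the convention $0^0 = 1$, whereas \<^term>\<open>(0::real) powr 0 = 0\<close>.\<close>

definition pow0 :: "real \<Rightarrow> real \<Rightarrow> real" where
  "pow0 t \<delta> = (if \<delta> = 0 then 1 else t powr \<delta>)"

definition reg_hessian ::
  "(real^'n \<Rightarrow> ereal) \<Rightarrow> (real^'n \<Rightarrow> ereal) \<Rightarrow> real \<Rightarrow> real \<Rightarrow> real \<Rightarrow> real^'n \<Rightarrow> real^'n^'n" where
  "reg_hessian f g c \<mu>\<^sub>1 \<delta> z =
     hess f z +
     (max 0 (- lambda_min (hess f z)) + c
        + \<mu>\<^sub>1 * min 1 (pow0 (norm (kkt_residual f g z)) \<delta>)) *\<^sub>R mat 1"

definition sufficient_decrease ::
  "('a::real_normed_vector \<Rightarrow> ereal) \<Rightarrow> real \<Rightarrow> real \<Rightarrow> 'a \<Rightarrow> 'a \<Rightarrow> nat \<Rightarrow> bool" where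
  "sufficient_decrease \<phi> \<tau> \<theta> z d j \<longleftrightarrow>
     \<phi> (z + \<theta>^j *\<^sub>R d) \<le> \<phi> z - ereal (\<tau> / 2 * \<theta>^j * (norm d)\<^sup>2)"

text \<open>\<open>ipn_sequence\<close>: the infinite sequences produced by the inexact proximal Newton method with
  matrices \<open>H\<close>; the line search is required to succeed, i.e. the exponent \<open>j k\<close> exists.\<close>

definition ipn_sequence ::
  "(real^'n \<Rightarrow> ereal) \<Rightarrow> (real^'n \<Rightarrow> ereal) \<Rightarrow> real \<Rightarrow> real \<Rightarrow> real \<Rightarrow> real \<Rightarrow>
   (nat \<Rightarrow> real^'n^'n) \<Rightarrow> (nat \<Rightarrow> real^'n) \<Rightarrow> bool" where
  "ipn_sequence f g \<tau> \<mu>\<^sub>2 \<delta> \<theta> H x \<longleftrightarrow>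
     (\<exists>(xhat :: nat \<Rightarrow> real^'n) (err :: nat \<Rightarrow> real^'n) (j :: nat \<Rightarrow> nat). \<forall>k.
        is_arg_min (\<lambda>y. quad_model f g y (x k) (H k) + ereal (err k \<bullet> (y - x k)))
          (\<lambda>_. True) (xhat k) \<and>
        norm (err k) \<le> \<mu>\<^sub>2 / 2 * min 1 (pow0 (norm (kkt_residual f g (x k))) \<delta>)
                        * norm (xhat k - x k) \<and>
        sufficient_decrease (\<lambda>y. f y + g y) \<tau> \<theta> (x k) (xhat k - x k) (j k) \<and>
        (\<forall>i<j k. \<not> sufficient_decrease (\<lambda>y. f y + g y) \<tau> \<theta> (x k) (xhat k - x k) i) \<and>
        x (Suc k) = x k + \<theta>^(j k) *\<^sub>R (xhat k - x k))"

text \<open>\<^term>\<open>infdist x {} = 0\<close>, whereas the usual convention is $+\infty$; the two differ only if there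
  is no stationary point. The inclusion in \<open>\<Omega>\<close>, where \<open>f\<close> is differentiable, says that the
  residual is defined on the whole ball.\<close>

definition metric_q_subregular_at ::
  "(real^'n) set \<Rightarrow> (real^'n \<Rightarrow> ereal) \<Rightarrow> (real^'n \<Rightarrow> ereal) \<Rightarrow> real \<Rightarrow> real^'n \<Rightarrow> bool" where
  "metric_q_subregular_at \<Omega> f g q z \<longleftrightarrow>
     (\<exists>\<epsilon>>0. \<exists>\<kappa>>0. ball z \<epsilon> \<subseteq> \<Omega> \<and>
        (\<forall>x\<in>ball z \<epsilon>.
           infdist x (stationary_points f g) \<le> \<kappa> * norm (kkt_residual f g x) powr q))"

definition converges_with_order :: "(nat \<Rightarrow> 'a::real_normed_vector) \<Rightarrow> 'a \<Rightarrow> real \<Rightarrow> bool" where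
  "converges_with_order x z q \<longleftrightarrow>
     x \<longlonglongrightarrow> z \<and>
     (\<exists>C. \<forall>\<^sub>F k in sequentially. norm (x (Suc k) - z) \<le> C * norm (x k - z) powr q)"

end

theory Submission
  imports Defs
begin

text \<open>The residual \<open>G\<close> is Lipschitz and vanishes exactly at the stationary points, so \<open>\<parallel>G y\<parallel>\<close> is at
  most a constant times the distance of \<open>y\<close> to them. Together with subregularity of order \<open>q > 1\<close>
  this gives \<open>\<parallel>G y\<parallel> \<le> C \<parallel>G y\<parallel>\<^sup>q\<close> near a cluster point, hence \<open>G y = 0\<close> as soon as \<open>G y\<close> is
  small. The line search accepts step sizes bounded away from 0, so the summable decrease of the
  objective forces \<open>G (x k)\<close> to tend to 0. Hence some iterate is stationary; from there on all
  steps are zero and the sequence is constant.\<close>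

section \<open>Second derivatives\<close>

text \<open>The link between the objective and \<open>G\<close> is the step
  \<open>d = xhat k - x k\<close>: sufficient decrease forces \<open>norm d\<close> to 0, and
  monotonicity of the subdifferential bounds \<open>norm (G (x k))\<close> by a fixed multiple of
  \<open>norm d\<close>. Both rest on a curvature budget. With
  \<open>m = min 1 (pow0 (norm (G (x k))) \<delta>)\<close>, the regularized matrix is at least
  \<open>c + \<mu>\<^sub>1 * m\<close> as a quadratic form, while the error vector costs at most
  \<open>\<mu>\<^sub>2 / 2 * m\<close>, so curvature \<open>c\<close> survives for every
  \<open>k\<close>; \<open>\<tau> < c\<close> then leaves room for the line search. The lower bound
  presupposes a symmetric Hessian, since otherwise \<open>lambda_min\<close> need not control the
  quadratic form. Symmetry is not part of \<open>twice_cont_diff_on\<close> and has to be derived.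
  Nearness to the cluster point is known only along a subsequence, but a single iterate with zero
  residual settles the whole tail, and the claimed rate then compares 0 with 0.\<close>

lemma second_difference_approx:
  fixes F :: "'a::real_inner \<Rightarrow> real"
  assumes "open S" "x \<in> S" and F: "\<And>y. y \<in> S \<Longrightarrow> GDERIV F y :> G y"
    and G: "(G has_derivative A) (at x)" and "e > 0"
  obtains d where "d > 0"
    "\<And>t. \<lbrakk>0 < t; t < d\<rbrakk> \<Longrightarrow>
       \<bar>(F (x + t *\<^sub>R u + t *\<^sub>R v) - F (x + t *\<^sub>R u) - F (x + t *\<^sub>R v) + F x) - t\<^sup>2 * (u \<bullet> A v)\<bar> \<le> e * t\<^sup>2"
proof -
  interpret A: bounded_linear A using G by (rule has_derivative_bounded_linear)
  define N where "N = norm u + norm v"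
  have N0: "N \<ge> 0" by (simp add: N_def)
  \<comment> \<open>The divisor is the factor collected in the final estimate, with 1 added to keep
    it positive when \<open>u = 0\<close>.\<close>
  define e' where "e' = e / (2 * norm u * N + 1)"
  have den: "2 * norm u * N + 1 > 0" using N0 by (smt (verit) mult_nonneg_nonneg norm_ge_zero)
  have e': "e' > 0" using \<open>e > 0\<close> den by (simp add: e'_def)
  obtain d1 where d1: "d1 > 0" "\<And>y. norm (y - x) < d1 \<Longrightarrow> norm (G y - G x - A (y - x)) \<le> e' * norm (y - x)"
    using G e' unfolding has_derivative_at_alt by blast
  obtain d2 where d2: "d2 > 0" "ball x d2 \<subseteq> S" using assms(1,2) open_contains_ball by blast
  define d where "d = min d1 d2 / (N + 1)"
  have d0: "d > 0" using d1 d2 N0 by (simp add: d_def)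
  have "\<bar>(F (x + t *\<^sub>R u + t *\<^sub>R v) - F (x + t *\<^sub>R u) - F (x + t *\<^sub>R v) + F x) - t\<^sup>2 * (u \<bullet> A v)\<bar> \<le> e * t\<^sup>2"
    if t: "0 < t" "t < d" for t
  proof -
    have tN: "t * N < min d1 d2"
    proof -
      have "t * N \<le> t * (N + 1)" using t by (simp add: mult_left_mono)
      also have "\<dots> < min d1 d2" using t N0 by (simp add: d_def field_simps)
      finally show ?thesis .
    qed
    have small1: "norm (s *\<^sub>R u + t *\<^sub>R v) \<le> t * N" "norm (s *\<^sub>R u) \<le> t * N" if "0 \<le> s" "s \<le> t" for s
    proof -
      have "norm (s *\<^sub>R u) \<le> t * norm u" using that by (simp add: mult_right_mono)
      moreover have "norm (t *\<^sub>R v) = t * norm v" using t by simp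
      moreover have "0 \<le> t * norm v" using t by simp
      ultimately show "norm (s *\<^sub>R u + t *\<^sub>R v) \<le> t * N" "norm (s *\<^sub>R u) \<le> t * N"
        using norm_triangle_ineq[of "s *\<^sub>R u" "t *\<^sub>R v"] unfolding N_def distrib_left by linarith+
    qed
    have inS: "x + w \<in> S" if "norm w \<le> t * N" for w
      using that tN d2 by (auto simp: dist_norm intro!: subsetD[OF d2(2)])
    have GA: "norm (G (x + w) - G x - A w) \<le> e' * (t * N)" if "norm w \<le> t * N" for w
    proof -
      have "norm (G (x + w) - G x - A (x + w - x)) \<le> e' * norm (x + w - x)"
        using that tN by (intro d1(2)) auto
      also have "\<dots> \<le> e' * (t * N)" using that e' by (intro mult_left_mono) auto
      finally show ?thesis by simp
    qed
    \<comment> \<open>The second difference is \<open>h t - h 0\<close>. The mean value theorem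
      turns it into \<open>t * h' \<sigma>\<close>; linearizing \<open>G\<close> around
      \<open>x\<close> at both arguments makes the unknown \<open>\<sigma>\<close> cancel and leaves
      \<open>t * (u \<bullet> A v)\<close>.\<close>
    define h where "h s = F (x + s *\<^sub>R u + t *\<^sub>R v) - F (x + s *\<^sub>R u)" for s
    define h' where "h' s = u \<bullet> (G (x + s *\<^sub>R u + t *\<^sub>R v) - G (x + s *\<^sub>R u))" for s
    have deriv: "(h has_real_derivative h' s) (at s)" if "0 \<le> s" "s \<le> t" for s
    proof -
      have 1: "(F has_derivative (\<lambda>k. k \<bullet> G (x + s *\<^sub>R u + t *\<^sub>R v))) (at (x + s *\<^sub>R u + t *\<^sub>R v))"
        using F[of "x + s *\<^sub>R u + t *\<^sub>R v"] inS[OF small1(1)[OF that]] by (simp add: gderiv_def add.assoc)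
      have 2: "(F has_derivative (\<lambda>k. k \<bullet> G (x + s *\<^sub>R u))) (at (x + s *\<^sub>R u))"
        using F[of "x + s *\<^sub>R u"] inS[OF small1(2)[OF that]] by (simp add: gderiv_def)
      have a: "((\<lambda>s. x + s *\<^sub>R u + t *\<^sub>R v) has_derivative (\<lambda>k. k *\<^sub>R u)) (at s)"
        by (auto intro!: derivative_eq_intros)
      have b: "((\<lambda>s. x + s *\<^sub>R u) has_derivative (\<lambda>k. k *\<^sub>R u)) (at s)"
        by (auto intro!: derivative_eq_intros)
      have "(h has_derivative (\<lambda>k. (k *\<^sub>R u) \<bullet> G (x + s *\<^sub>R u + t *\<^sub>R v) - (k *\<^sub>R u) \<bullet> G (x + s *\<^sub>R u))) (at s)"
        unfolding h_def
        by (intro has_derivative_diff has_derivative_compose[OF a 1] has_derivative_compose[OF b 2])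
      then show ?thesis
        unfolding has_field_derivative_def
        by (rule has_derivative_eq_rhs) (auto simp: h'_def inner_diff_right algebra_simps)
    qed
    obtain \<sigma> where \<sigma>: "0 < \<sigma>" "\<sigma> < t" "h t - h 0 = (t - 0) * h' \<sigma>"
      using MVT2[of 0 t h h'] deriv t by auto
    define E1 where "E1 = G (x + (\<sigma> *\<^sub>R u + t *\<^sub>R v)) - G x - A (\<sigma> *\<^sub>R u + t *\<^sub>R v)"
    define E2 where "E2 = G (x + \<sigma> *\<^sub>R u) - G x - A (\<sigma> *\<^sub>R u)"
    have E: "norm E1 \<le> e' * (t * N)" "norm E2 \<le> e' * (t * N)"
      unfolding E1_def E2_def using \<sigma> by (auto intro!: GA small1)
    have "h' \<sigma> = t * (u \<bullet> A v) + u \<bullet> (E1 - E2)"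
      unfolding h'_def E1_def E2_def by (simp add: A.add A.scaleR algebra_simps inner_simps)
    then have "h t - h 0 - t\<^sup>2 * (u \<bullet> A v) = t * (u \<bullet> (E1 - E2))"
      unfolding \<sigma>(3) by (simp add: power2_eq_square distrib_left)
    also have "\<bar>\<dots>\<bar> \<le> t * (norm u * (2 * (e' * (t * N))))"
    proof -
      have "\<bar>u \<bullet> (E1 - E2)\<bar> \<le> norm u * norm (E1 - E2)" by (rule Cauchy_Schwarz_ineq2)
      also have "\<dots> \<le> norm u * (2 * (e' * (t * N)))"
        using E norm_triangle_ineq4[of E1 E2] by (intro mult_left_mono) auto
      finally show ?thesis using t by (simp add: abs_mult mult_left_mono)
    qed
    also have "\<dots> = t\<^sup>2 * (e' * (2 * norm u * N))" by (simp add: power2_eq_square)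
    also have "\<dots> \<le> t\<^sup>2 * e"
    proof (intro mult_left_mono)
      have "e' * (2 * norm u * N) \<le> e' * (2 * norm u * N + 1)" using e' by simp
      also have "\<dots> = e" using den by (simp add: e'_def)
      finally show "e' * (2 * norm u * N) \<le> e" .
    qed simp
    finally show ?thesis by (simp add: h_def algebra_simps)
  qed
  then show thesis using d0 that by blast
qed

text \<open>The second difference is unchanged when \<open>u\<close> and \<open>v\<close> are
  swapped, yet to second order in \<open>t\<close> it determines both bilinear values.\<close>

lemma second_derivative_symmetric:
  fixes F :: "'a::real_inner \<Rightarrow> real"
  assumes "open S" "x \<in> S" "\<And>y. y \<in> S \<Longrightarrow> GDERIV F y :> G y"
    and "(G has_derivative A) (at x)"
  shows "u \<bullet> A v = v \<bullet> A u"
proof (rule ccontr)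
  assume "u \<bullet> A v \<noteq> v \<bullet> A u"
  \<comment> \<open>With a quarter of the gap, the two approximation errors sum to
    \<open>2 * e * t\<^sup>2\<close>, short of the gap \<open>4 * e * t\<^sup>2\<close>.\<close>
  define e where "e = \<bar>u \<bullet> A v - v \<bullet> A u\<bar> / 4"
  have e: "e > 0" using \<open>u \<bullet> A v \<noteq> v \<bullet> A u\<close> by (simp add: e_def)
  obtain d1 where d1: "d1 > 0" "\<And>t. \<lbrakk>0 < t; t < d1\<rbrakk> \<Longrightarrow>
       \<bar>(F (x + t *\<^sub>R u + t *\<^sub>R v) - F (x + t *\<^sub>R u) - F (x + t *\<^sub>R v) + F x) - t\<^sup>2 * (u \<bullet> A v)\<bar> \<le> e * t\<^sup>2"
    using second_difference_approx[OF assms e, of u v] by blast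
  obtain d2 where d2: "d2 > 0" "\<And>t. \<lbrakk>0 < t; t < d2\<rbrakk> \<Longrightarrow>
       \<bar>(F (x + t *\<^sub>R v + t *\<^sub>R u) - F (x + t *\<^sub>R v) - F (x + t *\<^sub>R u) + F x) - t\<^sup>2 * (v \<bullet> A u)\<bar> \<le> e * t\<^sup>2"
    using second_difference_approx[OF assms e, of v u] by blast
  define t where "t = min d1 d2 / 2"
  have t: "t > 0" "t < d1" "t < d2" using d1 d2 by (auto simp: t_def)
  have comm: "x + t *\<^sub>R v + t *\<^sub>R u = x + t *\<^sub>R u + t *\<^sub>R v" by simp
  have "\<bar>t\<^sup>2 * (u \<bullet> A v) - t\<^sup>2 * (v \<bullet> A u)\<bar> \<le> 2 * (e * t\<^sup>2)"
    using d1(2)[OF t(1,2)] d2(2)[OF t(1,3)] unfolding comm by linarith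
  also have "\<bar>t\<^sup>2 * (u \<bullet> A v) - t\<^sup>2 * (v \<bullet> A u)\<bar> = t\<^sup>2 * (4 * e)"
    by (simp add: e_def abs_mult flip: right_diff_distrib)
  finally have "t\<^sup>2 * (4 * e) \<le> t\<^sup>2 * (2 * e)" by (simp add: mult_ac)
  then show False using t e by simp
qed

lemma norm_derivative_le_lipschitz:
  fixes G :: "'a::real_normed_vector \<Rightarrow> 'b::real_normed_vector"
  assumes "open S" "x \<in> S" "L-lipschitz_on S G" and G: "(G has_derivative A) (at x)"
  shows "norm (A v) \<le> L * norm v"
proof (cases "v = 0")
  case True
  then show ?thesis using linear_0[OF has_derivative_linear[OF G]] by simp
next
  case False
  interpret A: bounded_linear A using G by (rule has_derivative_bounded_linear)
  show ?thesis
  proof (rule field_le_epsilon)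
    fix e :: real assume "e > 0"
    define e' where "e' = e / norm v"
    have e': "e' > 0" using \<open>e > 0\<close> False by (simp add: e'_def)
    obtain d1 where d1: "d1 > 0" "\<And>y. norm (y - x) < d1 \<Longrightarrow> norm (G y - G x - A (y - x)) \<le> e' * norm (y - x)"
      using G e' unfolding has_derivative_at_alt by blast
    obtain d2 where d2: "d2 > 0" "ball x d2 \<subseteq> S" using assms(1,2) open_contains_ball by blast
    define t where "t = min d1 d2 / (2 * norm v)"
    have t: "t > 0" "t * norm v < d1" "t * norm v < d2" using d1 d2 False by (auto simp: t_def)
    have "x + t *\<^sub>R v \<in> S" using t by (intro subsetD[OF d2(2)]) (auto simp: dist_norm)
    then have 1: "norm (G (x + t *\<^sub>R v) - G x) \<le> L * (t * norm v)"
      using lipschitz_onD[OF assms(3) _ \<open>x \<in> S\<close>, of "x + t *\<^sub>R v"] t by (simp add: dist_norm)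
    have 2: "norm (G (x + t *\<^sub>R v) - G x - t *\<^sub>R A v) \<le> e' * (t * norm v)"
      using d1(2)[of "x + t *\<^sub>R v"] t by (simp add: A.scaleR)
    have "t * norm (A v) = norm (t *\<^sub>R A v)" using t by simp
    also have "\<dots> \<le> L * (t * norm v) + e' * (t * norm v)"
      using 1 2 norm_triangle_ineq4[of "G (x + t *\<^sub>R v) - G x" "G (x + t *\<^sub>R v) - G x - t *\<^sub>R A v"] by simp
    also have "\<dots> = t * (L * norm v + e)" using False by (simp add: e'_def field_simps)
    finally show "norm (A v) \<le> L * norm v + e" using t by simp
  qed
qed

section \<open>The smallest eigenvalue of a symmetric matrix\<close>

text \<open>A minimizer \<open>w\<close> of the quadratic form on the unit sphere is an eigenvector,
  and its value lies below every eigenvalue. This also shows that the \<open>LEAST\<close> in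
  \<open>lambda_min\<close> is attained.\<close>

lemma symmetric_min_eigenvalue:
  fixes A :: "real^'n^'n"
  assumes sym: "\<And>u v. u \<bullet> (A *v v) = v \<bullet> (A *v u)"
  shows is_eigenvalue_lambda_min: "is_eigenvalue A (lambda_min A)"
    and lambda_min_le_quadratic_form: "lambda_min A * (norm v)\<^sup>2 \<le> v \<bullet> (A *v v)"
proof -
  have "continuous_on (sphere 0 1) (\<lambda>v. v \<bullet> (A *v v))"
    by (intro continuous_intros linear_continuous_on matrix_vector_mul_bounded_linear)
  moreover have "axis undefined 1 \<in> (sphere 0 1 :: (real^'n) set)" by simp
  then have "sphere 0 1 \<noteq> ({} :: (real^'n) set)" by blast
  ultimately obtain w :: "real^'n" where "w \<in> sphere 0 1"
    and "\<forall>v \<in> sphere 0 1. w \<bullet> (A *v w) \<le> v \<bullet> (A *v v)"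
    using continuous_attains_inf[OF compact_sphere] by blast
  then have w: "norm w = 1"
    and wmin: "\<And>v. norm v = 1 \<Longrightarrow> w \<bullet> (A *v w) \<le> v \<bullet> (A *v v)"
    by auto
  define m where "m = w \<bullet> (A *v w)"
  define B where "B v = A *v v - m *\<^sub>R v" for v
  have m_le: "m * (norm v)\<^sup>2 \<le> v \<bullet> (A *v v)" for v :: "real^'n"
  proof (cases "v = 0")
    case False
    have "m \<le> (v /\<^sub>R norm v) \<bullet> (A *v (v /\<^sub>R norm v))"
      unfolding m_def by (rule wmin) (use False in simp)
    also have "\<dots> = v \<bullet> (A *v v) / (norm v)\<^sup>2"
      by (simp add: matrix_vector_mult_scaleR power2_eq_square divide_inverse mult_ac)
    finally show ?thesis using False by (simp add: field_simps)
  qed simp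
  have Bpos: "0 \<le> v \<bullet> B v" for v
    using m_le[of v] by (simp add: B_def inner_diff_right power2_norm_eq_inner)
  have Bw: "w \<bullet> B w = 0"
    using w by (simp add: B_def inner_diff_right m_def dot_square_norm)
  have Badd: "B (u + v) = B u + B v" "B (t *\<^sub>R v) = t *\<^sub>R B v" for u v t
    by (simp_all add: B_def matrix_vector_right_distrib matrix_vector_mult_scaleR algebra_simps)
  have Bsym: "u \<bullet> B v = v \<bullet> B u" for u v
    using sym[of u v] by (simp add: B_def inner_diff_right inner_commute)
  have "B w = 0"
  proof (rule ccontr)
    assume "B w \<noteq> 0"
    define n where "n = B w \<bullet> B w"
    define b where "b = B w \<bullet> B (B w)"
    have n: "n > 0" using \<open>B w \<noteq> 0\<close> by (simp add: n_def)
    have b: "b \<ge> 0" using Bpos by (simp add: b_def)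
    \<comment> \<open>Moving \<open>w\<close> by \<open>s\<close> times \<open>- B w\<close> gives
      the form of \<open>B\<close> the value \<open>s * (s * b - 2 * n)\<close>. This
      \<open>s\<close> ensures \<open>s * b \<le> n\<close>, so the value would be negative.\<close>
    define s where "s = n / (b + 1)"
    have s: "s > 0" using n b by (simp add: s_def)
    have "0 \<le> (w + (-s) *\<^sub>R B w) \<bullet> B (w + (-s) *\<^sub>R B w)" by (rule Bpos)
    also have "\<dots> = s * (s * b - 2 * n)"
      unfolding Badd using Bw Bsym[of w "B w"]
      by (simp add: inner_simps n_def b_def algebra_simps)
    finally have "2 * n \<le> s * b" using s by (simp add: zero_le_mult_iff)
    also have "s * b \<le> n" using n b by (simp add: s_def field_simps)
    finally show False using n by simp
  qed
  then have eig: "is_eigenvalue A m"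
    using w unfolding is_eigenvalue_def B_def by (intro exI[of _ w]) auto
  have "lambda_min A = m"
    unfolding lambda_min_def
  proof (rule Least_equality)
    show "is_eigenvalue A m" by (rule eig)
  next
    fix l assume "is_eigenvalue A l"
    then obtain v where v: "v \<noteq> 0" "A *v v = l *\<^sub>R v" by (auto simp: is_eigenvalue_def)
    then have "m * (norm v)\<^sup>2 \<le> l * (norm v)\<^sup>2" using m_le[of v] by (simp add: power2_norm_eq_inner)
    then show "m \<le> l" using v by simp
  qed
  then show "is_eigenvalue A (lambda_min A)" "lambda_min A * (norm v)\<^sup>2 \<le> v \<bullet> (A *v v)"
    using eig m_le by auto
qed

lemma abs_eigenvalue_le:
  fixes A :: "real^'n^'n"
  assumes "is_eigenvalue A l" "\<And>v. norm (A *v v) \<le> L * norm v"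
  shows "\<bar>l\<bar> \<le> L"
proof -
  obtain v where v: "v \<noteq> 0" "A *v v = l *\<^sub>R v" using assms(1) by (auto simp: is_eigenvalue_def)
  then show ?thesis using assms(2)[of v] by simp
qed

section \<open>Convex functions and the proximal map\<close>

lemma real_of_effective_dom:
  assumes "proper_fun g" "y \<in> effective_dom g"
  shows "g y = ereal (real_of_ereal (g y))"
  using assms by (cases "g y") (auto simp: proper_fun_def effective_dom_def)

lemma convex_fun_effective_dom:
  assumes "proper_fun g" "convex_fun g" "y \<in> effective_dom g" "z \<in> effective_dom g" "0 \<le> t" "t \<le> 1"
  shows "y + t *\<^sub>R (z - y) \<in> effective_dom g"
    and "real_of_ereal (g (y + t *\<^sub>R (z - y))) \<le> (1 - t) * real_of_ereal (g y) + t * real_of_ereal (g z)"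
proof -
  let ?r = "\<lambda>y. real_of_ereal (g y)"
  have "(y, ?r y) \<in> ereal_epigraph g" "(z, ?r z) \<in> ereal_epigraph g"
    using real_of_effective_dom[OF assms(1)] assms(3,4) by (simp_all add: ereal_epigraph_def)
  then have "(1 - t) *\<^sub>R (y, ?r y) + t *\<^sub>R (z, ?r z) \<in> ereal_epigraph g"
    using assms(2,5,6) by (intro convexD) (auto simp: convex_fun_def)
  moreover have "(1 - t) *\<^sub>R y + t *\<^sub>R z = y + t *\<^sub>R (z - y)"
    by (simp add: algebra_simps)
  ultimately have *: "g (y + t *\<^sub>R (z - y)) \<le> ereal ((1 - t) * ?r y + t * ?r z)"
    by (simp add: ereal_epigraph_def)
  then show "y + t *\<^sub>R (z - y) \<in> effective_dom g"
    unfolding effective_dom_def by (auto simp: le_less_trans)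
  then show "?r (y + t *\<^sub>R (z - y)) \<le> (1 - t) * ?r y + t * ?r z"
    using * real_of_effective_dom[OF assms(1)] by (metis ereal_less_eq(3))
qed

lemma subdifferential_iff:
  assumes "proper_fun g"
  shows "v \<in> subdifferential g y \<longleftrightarrow> y \<in> effective_dom g \<and>
    (\<forall>z \<in> effective_dom g. real_of_ereal (g y) + v \<bullet> (z - y) \<le> real_of_ereal (g z))"
    (is "_ \<longleftrightarrow> _ \<and> ?R")
proof (cases "y \<in> effective_dom g")
  case True
  have "g y + ereal (v \<bullet> (z - y)) \<le> g z \<longleftrightarrow>
      (z \<in> effective_dom g \<longrightarrow> real_of_ereal (g y) + v \<bullet> (z - y) \<le> real_of_ereal (g z))" for z
  proof (cases "z \<in> effective_dom g")
    case z: True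
    obtain a b where "g y = ereal a" "g z = ereal b"
      using real_of_effective_dom[OF assms] True z by metis
    then show ?thesis using z by simp
  next
    case False
    then show ?thesis by (simp add: effective_dom_def)
  qed
  then show ?thesis using True by (auto simp: subdifferential_def)
qed (simp add: subdifferential_def)

lemma subdifferential_monotone:
  assumes "proper_fun g" "v \<in> subdifferential g y" "w \<in> subdifferential g z"
  shows "0 \<le> (v - w) \<bullet> (y - z)"
proof -
  have "real_of_ereal (g y) + v \<bullet> (z - y) \<le> real_of_ereal (g z)"
    "real_of_ereal (g z) + w \<bullet> (y - z) \<le> real_of_ereal (g y)"
    using assms by (auto simp: subdifferential_iff)
  then show ?thesis by (simp add: inner_diff_left inner_diff_right)
qed

text \<open>Along the segment from \<open>p\<close> to \<open>y\<close>, convexity bounds the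
  increment of \<open>g\<close> linearly in \<open>t\<close>, and \<open>h\<close> contributes its
  one-sided derivative. Convexity of \<open>h\<close> never enters, so the lemma covers the proximal
  objective, the perturbed quadratic model and \<open>f\<close> itself.\<close>

lemma minimizer_imp_subgradient:
  fixes g :: "'a::real_inner \<Rightarrow> ereal"
  assumes g: "proper_fun g" "convex_fun g" and p: "p \<in> effective_dom g"
    and h: "GDERIV h p :> w"
    and min: "\<And>y. y \<in> effective_dom g \<Longrightarrow> real_of_ereal (g p) + h p \<le> real_of_ereal (g y) + h y"
  shows "- w \<in> subdifferential g p"
  unfolding subdifferential_iff[OF g(1)]
proof (intro conjI ballI p)
  fix y assume y: "y \<in> effective_dom g"
  let ?r = "\<lambda>y. real_of_ereal (g y)"
  let ?h = "\<lambda>t. h (p + t *\<^sub>R (y - p))"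
  have a: "((\<lambda>t. p + t *\<^sub>R (y - p)) has_derivative (\<lambda>k. k *\<^sub>R (y - p))) (at 0)"
    by (auto intro!: derivative_eq_intros)
  have b: "(h has_derivative (\<lambda>k. k \<bullet> w)) (at (p + 0 *\<^sub>R (y - p)))"
    using h by (simp add: gderiv_def)
  have "(?h has_real_derivative (y - p) \<bullet> w) (at 0)"
    unfolding has_field_derivative_def
    by (rule has_derivative_eq_rhs[OF has_derivative_compose[OF a b]]) (auto simp: mult.commute)
  then have "((\<lambda>t. (?h t - ?h 0) / (t - 0)) \<longlongrightarrow> (y - p) \<bullet> w) (at 0)"
    by (simp add: has_field_derivative_iff)
  then have "((\<lambda>t. (?h t - ?h 0) / (t - 0)) \<longlongrightarrow> (y - p) \<bullet> w) (at_right 0)"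
    by (rule tendsto_within_subset) simp
  then have "?r p - ?r y \<le> (y - p) \<bullet> w"
  proof (rule tendsto_lowerbound)
    have "?r p - ?r y \<le> (?h t - ?h 0) / (t - 0)" if t: "0 < t" "t < 1" for t
    proof -
      have "?r p + h p \<le> ?r (p + t *\<^sub>R (y - p)) + ?h t"
        using t convex_fun_effective_dom(1)[OF g p y] by (intro min) auto
      also have "?r (p + t *\<^sub>R (y - p)) \<le> (1 - t) * ?r p + t * ?r y"
        using t convex_fun_effective_dom(2)[OF g p y] by auto
      finally have "t * (?r p - ?r y) \<le> ?h t - ?h 0" by (simp add: algebra_simps)
      then show ?thesis using t by (simp add: field_simps)
    qed
    then show "\<forall>\<^sub>F t in at_right 0. ?r p - ?r y \<le> (?h t - ?h 0) / (t - 0)"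
      using eventually_at_right_real[of 0 1] by (auto elim!: eventually_mono)
  qed simp
  then show "?r p + (- w) \<bullet> (y - p) \<le> ?r y"
    by (simp add: inner_commute)
qed

text \<open>A subgradient at some point bounds \<open>g\<close> below by an affine function, which makes the
  objective of the proximal problem coercive.\<close>

lemma prox_minimizes:
  fixes g :: "'a::euclidean_space \<Rightarrow> ereal"
  assumes g: "proper_fun g" "closed_fun g" and v: "v \<in> subdifferential g z"
  shows "is_arg_min (\<lambda>y. g y + ereal (1/2 * (norm (y - u))\<^sup>2)) (\<lambda>_. True) (prox g u)"
proof -
  let ?r = "\<lambda>y. real_of_ereal (g y)"
  \<comment> \<open>The height becomes an extra variable: on the epigraph, closed by
    \<open>closed_fun\<close>, the objective is continuous, so compactness of a sublevel set
    suffices.\<close>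
  define \<Phi> where "\<Phi> = (\<lambda>p :: 'a \<times> real. snd p + 1/2 * (norm (fst p - u))\<^sup>2)"
  define M where "M = \<Phi> (z, ?r z)"
  define K where "K = ereal_epigraph g \<inter> {p. \<Phi> p \<le> M}"
  have z: "z \<in> effective_dom g" using v by (simp add: subdifferential_def)
  have lower: "?r z + v \<bullet> (fst p - z) \<le> snd p" if "p \<in> ereal_epigraph g" for p
  proof -
    have le: "g (fst p) \<le> ereal (snd p)" using that by (auto simp: ereal_epigraph_def)
    then have "fst p \<in> effective_dom g" by (auto simp: effective_dom_def le_less_trans)
    moreover from this have "?r (fst p) \<le> snd p"
      using le real_of_effective_dom[OF g(1)] by (metis ereal_less_eq(3))
    ultimately show ?thesis using v by (force simp: subdifferential_iff[OF g(1)])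
  qed
  have cont: "continuous_on S \<Phi>" for S
    unfolding \<Phi>_def by (intro continuous_intros)
  have "closed K"
    unfolding K_def using g(2) cont[of UNIV]
    by (intro closed_Int closed_Collect_le) (auto simp: closed_fun_def)
  moreover have "bounded K"
  proof -
    define C where "C = M - ?r z - v \<bullet> (u - z)"
    \<comment> \<open>If \<open>a = norm (fst p - u)\<close> exceeds \<open>R\<close>, then
      \<open>a \<ge> 1\<close> and the affine minorant gives
      \<open>a\<^sup>2 \<le> 2 * C + 2 * norm v * a \<le> (R - 1) * a\<close>, a
      contradiction.\<close>
    define R where "R = 1 + 2 * \<bar>C\<bar> + 2 * norm v"
    have near: "norm (fst p - u) \<le> R" if p: "p \<in> K" for p
    proof (rule ccontr)
      let ?a = "norm (fst p - u)"
      assume "\<not> ?a \<le> R"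
      then have a: "?a > R" by simp
      have a1: "?a \<ge> 1" using a norm_ge_zero[of v] unfolding R_def by linarith
      have "snd p + 1/2 * ?a\<^sup>2 \<le> M" using p by (simp add: K_def \<Phi>_def)
      moreover have "?r z + v \<bullet> (fst p - z) \<le> snd p" using p by (intro lower) (simp add: K_def)
      moreover have "v \<bullet> (fst p - z) = v \<bullet> (fst p - u) + v \<bullet> (u - z)" by (simp add: inner_diff_right)
      moreover have "- (norm v * ?a) \<le> v \<bullet> (fst p - u)"
        using Cauchy_Schwarz_ineq2[of v "fst p - u"] by linarith
      ultimately have "?a\<^sup>2 \<le> 2 * C + 2 * norm v * ?a" unfolding C_def mult.assoc by argo
      also have "\<dots> \<le> 2 * \<bar>C\<bar> * ?a + 2 * norm v * ?a"
        using mult_left_mono[OF a1, of "2 * \<bar>C\<bar>"] by simp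
      also have "\<dots> = (R - 1) * ?a" by (simp add: R_def algebra_simps)
      finally have "?a * ?a \<le> (R - 1) * ?a" by (simp add: power2_eq_square)
      then have "?a \<le> R - 1" using a1 by (intro mult_right_le_imp_le[of ?a ?a]) auto
      then show False using a by simp
    qed
    have snd_le: "norm (snd p) \<le> \<bar>M\<bar> + \<bar>?r z + v \<bullet> (u - z)\<bar> + norm v * R" if p: "p \<in> K" for p
    proof -
      have "snd p + 1/2 * (norm (fst p - u))\<^sup>2 \<le> M" using p by (simp add: K_def \<Phi>_def)
      then have "snd p \<le> M" using zero_le_power2[of "norm (fst p - u)"] by linarith
      moreover have "?r z + v \<bullet> (fst p - z) \<le> snd p" using p by (intro lower) (simp add: K_def)
      moreover have "v \<bullet> (fst p - z) = v \<bullet> (fst p - u) + v \<bullet> (u - z)" by (simp add: inner_diff_right)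
      moreover have "- (norm v * norm (fst p - u)) \<le> v \<bullet> (fst p - u)"
        using Cauchy_Schwarz_ineq2[of v "fst p - u"] by linarith
      moreover have "norm v * norm (fst p - u) \<le> norm v * R" by (intro mult_left_mono near p) simp
      moreover have "0 \<le> norm v * R" by (simp add: R_def)
      ultimately show ?thesis unfolding real_norm_def by linarith
    qed
    have "K \<subseteq> cball u R \<times> cball 0 (\<bar>M\<bar> + \<bar>?r z + v \<bullet> (u - z)\<bar> + norm v * R)"
      using near snd_le by (force simp: dist_norm norm_minus_commute)
    then show ?thesis by (rule bounded_subset[OF bounded_Times[OF bounded_cball bounded_cball]])
  qed
  ultimately have "compact K" by (simp add: compact_eq_bounded_closed)
  moreover have zK: "(z, ?r z) \<in> K"
    using real_of_effective_dom[OF g(1) z] by (simp add: K_def M_def ereal_epigraph_def)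
  ultimately obtain p where p: "p \<in> K" "\<And>p'. p' \<in> K \<Longrightarrow> \<Phi> p \<le> \<Phi> p'"
    using continuous_attains_inf[OF \<open>compact K\<close> _ cont] by blast
  have "g (fst p) + ereal (1/2 * (norm (fst p - u))\<^sup>2) \<le> g y + ereal (1/2 * (norm (y - u))\<^sup>2)" for y
  proof (cases "y \<in> effective_dom g")
    case True
    have "\<Phi> p \<le> \<Phi> (y, ?r y)"
    proof (cases "\<Phi> (y, ?r y) \<le> M")
      case le: True
      have "(y, ?r y) \<in> K"
        using le real_of_effective_dom[OF g(1) True] by (simp add: K_def ereal_epigraph_def)
      then show ?thesis by (rule p(2))
    next
      case False
      then show ?thesis using p(1) by (simp add: K_def)
    qed
    then have "ereal (snd p) + ereal (1/2 * (norm (fst p - u))\<^sup>2) \<le> ereal (?r y) + ereal (1/2 * (norm (y - u))\<^sup>2)"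
      by (simp add: \<Phi>_def)
    moreover have "g (fst p) \<le> ereal (snd p)" using p(1) by (auto simp: K_def ereal_epigraph_def)
    ultimately show ?thesis
      using real_of_effective_dom[OF g(1) True] by (metis add_right_mono order_trans)
  next
    case False
    then show ?thesis by (simp add: effective_dom_def)
  qed
  then have "is_arg_min (\<lambda>y. g y + ereal (1/2 * (norm (y - u))\<^sup>2)) (\<lambda>_. True) (fst p)"
    by (auto simp: is_arg_min_def not_less)
  then show ?thesis
    unfolding prox_def arg_min_def by (rule someI)
qed

lemma is_arg_min_effective_dom:
  assumes g: "proper_fun g" "z \<in> effective_dom g"
    and min: "is_arg_min F (\<lambda>_. True) p" and F: "\<And>y. F y = ereal (h y) + g y"
  shows "p \<in> effective_dom g"
    and "\<And>y. y \<in> effective_dom g \<Longrightarrow> real_of_ereal (g p) + h p \<le> real_of_ereal (g y) + h y"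
proof -
  have le: "ereal (h p) + g p \<le> ereal (h y) + g y" for y
    using min unfolding F is_arg_min_def by (auto simp: not_less)
  show p: "p \<in> effective_dom g"
    using le[of z] real_of_effective_dom[OF g] by (cases "g p") (auto simp: effective_dom_def)
  fix y assume y: "y \<in> effective_dom g"
  show "real_of_ereal (g p) + h p \<le> real_of_ereal (g y) + h y"
    using le[of y] real_of_effective_dom[OF g(1) p] real_of_effective_dom[OF g(1) y]
    by (metis add.commute ereal_less_eq(3) plus_ereal.simps(1))
qed

text \<open>First-order optimality for the proximal problem. The subgradient \<open>v\<close>
  guarantees, through \<open>prox_minimizes\<close>, that the value chosen by \<open>arg_min\<close>
  really is a minimizer.\<close>

lemma subgradient_prox:
  fixes g :: "'a::euclidean_space \<Rightarrow> ereal"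
  assumes g: "proper_fun g" "closed_fun g" "convex_fun g" and v: "v \<in> subdifferential g z"
  shows "u - prox g u \<in> subdifferential g (prox g u)"
proof -
  let ?h = "\<lambda>y. 1/2 * (norm (y - u))\<^sup>2"
  have z: "z \<in> effective_dom g" using v by (simp add: subdifferential_def)
  note * = is_arg_min_effective_dom[OF g(1) z prox_minimizes[OF g(1,2) v], where h = ?h]
  have "GDERIV ?h (prox g u) :> prox g u - u"
    unfolding gderiv_def power2_norm_eq_inner
    by (auto intro!: derivative_eq_intros simp: inner_commute)
  then have "- (prox g u - u) \<in> subdifferential g (prox g u)"
    using * by (intro minimizer_imp_subgradient[OF g(1,3)]) (auto simp: add.commute)
  then show ?thesis by simp
qed

text \<open>Pairing the subgradients at \<open>prox g u\<close> and \<open>p\<close> gives minus the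
  squared distance of these points, which monotonicity makes nonnegative.\<close>

lemma prox_eqI:
  fixes g :: "'a::euclidean_space \<Rightarrow> ereal"
  assumes g: "proper_fun g" "closed_fun g" "convex_fun g" and p: "u - p \<in> subdifferential g p"
  shows "prox g u = p"
proof -
  have "0 \<le> ((u - prox g u) - (u - p)) \<bullet> (prox g u - p)"
    by (rule subdifferential_monotone[OF g(1) subgradient_prox[OF g p] p])
  also have "\<dots> = - ((prox g u - p) \<bullet> (prox g u - p))" by (simp add: inner_simps)
  finally have "(prox g u - p) \<bullet> (prox g u - p) \<le> 0" by simp
  then show ?thesis by (metis eq_iff_diff_eq_0 inner_gt_zero_iff linorder_not_less)
qed

lemma prox_nonexpansive:
  fixes g :: "'a::euclidean_space \<Rightarrow> ereal"
  assumes g: "proper_fun g" "closed_fun g" "convex_fun g" and v: "v \<in> subdifferential g z"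
  shows "norm (prox g u - prox g w) \<le> norm (u - w)"
proof -
  let ?p = "prox g u - prox g w"
  have "0 \<le> ((u - prox g u) - (w - prox g w)) \<bullet> ?p"
    by (rule subdifferential_monotone[OF g(1) subgradient_prox[OF g v] subgradient_prox[OF g v]])
  also have "\<dots> = (u - w) \<bullet> ?p - ?p \<bullet> ?p" by (simp add: inner_diff_left)
  finally have "norm ?p * norm ?p \<le> (u - w) \<bullet> ?p"
    by (simp add: dot_square_norm power2_eq_square)
  also have "\<dots> \<le> norm (u - w) * norm ?p" by (rule norm_cauchy_schwarz)
  finally show ?thesis by (cases "?p = 0") (auto simp: mult_le_cancel_right)
qed

section \<open>The proximal Newton step\<close>

text \<open>A solution is used in three ways: it yields a subgradient of \<open>g\<close>, hence
  existence of proximal points; it makes the set of stationary points nonempty, so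
  \<open>infdist\<close> is a true distance; and it bounds the objective from below.\<close>

locale composite_problem =
  fixes f g :: "real^'n \<Rightarrow> ereal" and \<Omega> :: "(real^'n) set" and L :: real
  assumes open_\<Omega>: "open \<Omega>" and dom_subset: "effective_dom g \<subseteq> \<Omega>"
    and C2: "twice_cont_diff_on \<Omega> f" and lipschitz: "L-lipschitz_on \<Omega> (grad f)"
    and proper: "proper_fun g" and closed: "closed_fun g" and convex: "convex_fun g"
    and solvable: "\<exists>z \<in> effective_dom g. \<forall>y \<in> effective_dom g. f z + g z \<le> f y + g y"
begin

abbreviation "fr y \<equiv> real_of_ereal (f y)"
abbreviation "gr y \<equiv> real_of_ereal (g y)"
abbreviation "G \<equiv> kkt_residual f g"

section \<open>Derivatives of \<open>f\<close> and bounds on the regularized Hessian\<close>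

lemma f_real: "y \<in> \<Omega> \<Longrightarrow> f y = ereal (fr y)"
  using C2 by (simp add: twice_cont_diff_on_def ereal_real)

lemmas g_real = real_of_effective_dom[OF proper]

lemma objective_real: "y \<in> effective_dom g \<Longrightarrow> f y + g y = ereal (fr y + gr y)"
  using f_real[of y] g_real[of y] dom_subset by (metis plus_ereal.simps(1) subsetD)

lemma L_nonneg: "L \<ge> 0"
  using lipschitz by (rule lipschitz_on_nonneg)

text \<open>The adjoint of the derivative, applied to 1, represents it as an inner product;
  uniqueness of this vector resolves the \<open>THE\<close> in \<open>grad\<close>.\<close>

lemma grad:
  assumes "y \<in> \<Omega>" shows "GDERIV fr y :> grad f y"
proof -
  obtain D where D: "(fr has_derivative D) (at y)"
    using C2 assms by (auto simp: twice_cont_diff_on_def differentiable_def)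
  interpret D: bounded_linear D using D by (rule has_derivative_bounded_linear)
  have "D = (\<lambda>h. h \<bullet> adjoint D 1)"
    using adjoint_works[OF D.linear, of _ 1] by auto
  then have "GDERIV fr y :> adjoint D 1" using D by (simp add: gderiv_def)
  moreover have "E = E'" if "GDERIV fr y :> E" "GDERIV fr y :> E'" for E E'
    using has_derivative_unique that unfolding gderiv_def by (metis vector_eq_ldot)
  ultimately show ?thesis unfolding grad_def by (metis theI)
qed

lemma grad_has_derivative:
  assumes "y \<in> \<Omega>" shows "(grad f has_derivative (\<lambda>v. hess f y *v v)) (at y)"
proof -
  have D: "(grad f has_derivative frechet_derivative (grad f) (at y)) (at y)"
    using C2 assms by (simp add: twice_cont_diff_on_def flip: frechet_derivative_works)
  then have "hess f y *v v = frechet_derivative (grad f) (at y) v" for v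
    unfolding hess_def
    by (intro matrix_works) (simp add: has_derivative_linear linear_matrix_vector_mul_eq)
  then show ?thesis using D by simp
qed

lemma hess_symmetric: "y \<in> \<Omega> \<Longrightarrow> u \<bullet> (hess f y *v v) = v \<bullet> (hess f y *v u)"
  by (rule second_derivative_symmetric[OF open_\<Omega> _ grad grad_has_derivative])

lemma norm_hess_le: "y \<in> \<Omega> \<Longrightarrow> norm (hess f y *v v) \<le> L * norm v"
  by (rule norm_derivative_le_lipschitz[OF open_\<Omega> _ lipschitz grad_has_derivative])

text \<open>The shift cancels any negative part of the spectrum and adds \<open>r\<close>, whence
  the lower bound. As \<open>lambda_min\<close> is an eigenvalue it is at most \<open>L\<close> in
  modulus, so the Hessian and its shift contribute \<open>L\<close> each to
  \<open>2 * L\<close>.\<close>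

lemma reg_hessian_bounds:
  fixes \<delta> :: real
  assumes y: "y \<in> \<Omega>" and "0 < c" "0 < \<mu>"
  defines "r \<equiv> c + \<mu> * min 1 (pow0 (norm (G y)) \<delta>)"
  shows "r * (norm v)\<^sup>2 \<le> v \<bullet> (reg_hessian f g c \<mu> \<delta> y *v v)"
    and "norm (reg_hessian f g c \<mu> \<delta> y *v v) \<le> (2 * L + c + \<mu>) * norm v"
proof -
  define s where "s = max 0 (- lambda_min (hess f y)) + r"
  have r: "0 < r" "r \<le> c + \<mu>" using assms(2,3) by (auto simp: r_def pow0_def add_pos_nonneg)
  have H: "reg_hessian f g c \<mu> \<delta> y *v v = hess f y *v v + s *\<^sub>R v" for v
    unfolding reg_hessian_def s_def r_def
    by (simp add: matrix_vector_mult_add_rdistrib add.assoc flip: scaleR_matrix_vector_assoc)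
  have "lambda_min (hess f y) * (norm v)\<^sup>2 \<le> v \<bullet> (hess f y *v v)"
    by (rule lambda_min_le_quadratic_form[OF hess_symmetric[OF y]])
  moreover have "- lambda_min (hess f y) * (norm v)\<^sup>2 \<le> (s - r) * (norm v)\<^sup>2"
    by (intro mult_right_mono) (auto simp: s_def)
  ultimately show "r * (norm v)\<^sup>2 \<le> v \<bullet> (reg_hessian f g c \<mu> \<delta> y *v v)"
    unfolding H by (simp add: inner_add_right algebra_simps flip: power2_norm_eq_inner)
  have "\<bar>lambda_min (hess f y)\<bar> \<le> L"
    by (rule abs_eigenvalue_le[OF is_eigenvalue_lambda_min[OF hess_symmetric[OF y]] norm_hess_le[OF y]])
  then have s: "0 \<le> s" "s \<le> L + c + \<mu>" using r L_nonneg by (auto simp: s_def)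
  have "norm (hess f y *v v + s *\<^sub>R v) \<le> L * norm v + s * norm v"
    using norm_triangle_ineq[of "hess f y *v v" "s *\<^sub>R v"] norm_hess_le[OF y, of v] s by simp
  also have "\<dots> = (L + s) * norm v" by (simp add: distrib_right)
  also have "\<dots> \<le> (2 * L + c + \<mu>) * norm v" using s by (intro mult_right_mono) auto
  finally show "norm (reg_hessian f g c \<mu> \<delta> y *v v) \<le> (2 * L + c + \<mu>) * norm v" unfolding H .
qed

lemma reg_hessian_symmetric:
  assumes "y \<in> \<Omega>"
  shows "u \<bullet> (reg_hessian f g c \<mu> \<delta> y *v v) = v \<bullet> (reg_hessian f g c \<mu> \<delta> y *v u)"
  unfolding reg_hessian_def using hess_symmetric[OF assms, of u v]
  by (simp add: matrix_vector_mult_add_rdistrib inner_add_right inner_commute flip: scaleR_matrix_vector_assoc)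

text \<open>Convexity is available for \<open>effective_dom g\<close>, not for
  \<open>\<Omega>\<close>; endpoints in the former keep the whole segment where the gradient is
  Lipschitz.\<close>

lemma descent:
  assumes y: "y \<in> effective_dom g" and z: "z \<in> effective_dom g"
  shows "fr z \<le> fr y + grad f y \<bullet> (z - y) + L / 2 * (norm (z - y))\<^sup>2"
proof -
  define d where "d = z - y"
  define \<psi> where "\<psi> t = fr (y + t *\<^sub>R d) - t * (grad f y \<bullet> d) - L / 2 * t\<^sup>2 * (norm d)\<^sup>2" for t
  have "\<psi> 1 \<le> \<psi> 0"
  proof (rule DERIV_nonpos_imp_nonincreasing[of 0 1 \<psi>])
    fix t :: real assume t: "0 \<le> t" "t \<le> 1"
    have in\<Omega>: "y + t *\<^sub>R d \<in> \<Omega>"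
      using convex_fun_effective_dom(1)[OF proper convex y z t] dom_subset by (auto simp: d_def)
    have a: "((\<lambda>t. y + t *\<^sub>R d) has_derivative (\<lambda>k. k *\<^sub>R d)) (at t)"
      by (auto intro!: derivative_eq_intros)
    have "((\<lambda>t. fr (y + t *\<^sub>R d)) has_real_derivative d \<bullet> grad f (y + t *\<^sub>R d)) (at t)"
      unfolding has_field_derivative_def
      by (rule has_derivative_eq_rhs[OF has_derivative_compose[OF a grad[OF in\<Omega>, unfolded gderiv_def]]])
        (auto simp: mult.commute)
    then have "(\<psi> has_real_derivative
        d \<bullet> grad f (y + t *\<^sub>R d) - grad f y \<bullet> d - L / 2 * (2 * t) * (norm d)\<^sup>2) (at t)"
      unfolding \<psi>_def by (auto intro!: derivative_eq_intros)
    moreover have "d \<bullet> grad f (y + t *\<^sub>R d) - grad f y \<bullet> d - L / 2 * (2 * t) * (norm d)\<^sup>2 \<le> 0"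
    proof -
      have "(grad f (y + t *\<^sub>R d) - grad f y) \<bullet> d \<le> norm (grad f (y + t *\<^sub>R d) - grad f y) * norm d"
        by (rule norm_cauchy_schwarz)
      also have "\<dots> \<le> (L * (t * norm d)) * norm d"
        using lipschitz_onD[OF lipschitz in\<Omega>, of y] y dom_subset t
        by (intro mult_right_mono) (auto simp: dist_norm)
      finally show ?thesis
        by (simp add: inner_diff_left inner_diff_right inner_commute power2_eq_square mult_ac)
    qed
    ultimately show "\<exists>y. DERIV \<psi> t :> y \<and> y \<le> 0" by blast
  qed simp
  then show ?thesis by (simp add: \<psi>_def d_def)
qed

section \<open>Stationary points and the residual\<close>

lemma stationary_points_iff: "y \<in> stationary_points f g \<longleftrightarrow> - grad f y \<in> subdifferential g y"
  unfolding stationary_points_def by (auto simp: add_eq_0_iff image_iff)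

lemma stationary_points_nonempty: "stationary_points f g \<noteq> {}"
proof -
  obtain z where z: "z \<in> effective_dom g"
    and min: "\<And>y. y \<in> effective_dom g \<Longrightarrow> f z + g z \<le> f y + g y"
    using solvable by blast
  have "- grad f z \<in> subdifferential g z"
    using z dom_subset min
    by (intro minimizer_imp_subgradient[OF proper convex z grad]) (auto simp: objective_real add.commute)
  then show ?thesis using stationary_points_iff by blast
qed

lemma subgradient_residual: "G y - grad f y \<in> subdifferential g (y - G y)"
proof -
  obtain z where "- grad f z \<in> subdifferential g z"
    using stationary_points_nonempty stationary_points_iff by blast
  then show ?thesis
    using subgradient_prox[OF proper closed convex, of _ z "y - grad f y"]
    by (simp add: kkt_residual_def algebra_simps)
qed

lemma residual_eq_0_iff: "G y = 0 \<longleftrightarrow> y \<in> stationary_points f g"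
proof
  assume "G y = 0"
  then show "y \<in> stationary_points f g"
    using subgradient_residual[of y] by (simp add: stationary_points_iff)
next
  assume "y \<in> stationary_points f g"
  then have "prox g (y - grad f y) = y"
    by (intro prox_eqI[OF proper closed convex]) (simp add: stationary_points_iff)
  then show "G y = 0" by (simp add: kkt_residual_def)
qed

text \<open>The identity contributes 1 and the nonexpansive prox of \<open>y - grad f y\<close>
  contributes \<open>1 + L\<close>.\<close>

lemma residual_lipschitz:
  assumes "y \<in> \<Omega>" "z \<in> \<Omega>"
  shows "norm (G y - G z) \<le> (2 + L) * norm (y - z)"
proof -
  obtain s where s: "- grad f s \<in> subdifferential g s"
    using stationary_points_nonempty stationary_points_iff by blast
  let ?py = "prox g (y - grad f y)" and ?pz = "prox g (z - grad f z)"
  have gr: "norm (grad f y - grad f z) \<le> L * norm (y - z)"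
    using lipschitz_onD[OF lipschitz assms] by (simp add: dist_norm)
  have "norm (?py - ?pz) \<le> norm ((y - grad f y) - (z - grad f z))"
    by (rule prox_nonexpansive[OF proper closed convex s])
  also have "\<dots> \<le> norm (y - z) + norm (grad f y - grad f z)"
    using norm_triangle_ineq4[of "y - z" "grad f y - grad f z"] by (simp add: algebra_simps)
  finally have "norm (?py - ?pz) \<le> (1 + L) * norm (y - z)" using gr by (simp add: distrib_right)
  moreover have "norm (G y - G z) \<le> norm (y - z) + norm (?py - ?pz)"
    using norm_triangle_ineq4[of "y - z" "?py - ?pz"] by (simp add: kkt_residual_def algebra_simps)
  ultimately show ?thesis by (simp add: distrib_right)
qed

lemma residual_le_infdist:
  assumes "y \<in> \<Omega>"
  shows "norm (G y) \<le> (2 + L) * infdist y (stationary_points f g)"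
proof -
  have "norm (G y) / (2 + L) \<le> infdist y (stationary_points f g)"
    unfolding infdist_notempty[OF stationary_points_nonempty]
  proof (rule cINF_greatest[OF stationary_points_nonempty])
    fix s assume s: "s \<in> stationary_points f g"
    then have "s \<in> \<Omega>" using dom_subset by (auto simp: stationary_points_iff subdifferential_def)
    moreover have "G s = 0" using s residual_eq_0_iff by blast
    ultimately show "norm (G y) / (2 + L) \<le> dist y s"
      using residual_lipschitz[OF assms, of s] L_nonneg by (simp add: dist_norm field_simps)
  qed
  then show ?thesis using L_nonneg by (simp add: field_simps)
qed

lemma residual_eq_0_if_small:
  assumes y: "y \<in> \<Omega>" and q: "infdist y (stationary_points f g) \<le> \<kappa> * norm (G y) powr q"
    and small: "(2 + L) * \<kappa> * norm (G y) powr (q - 1) < 1"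
  shows "G y = 0"
proof (rule ccontr)
  assume "G y \<noteq> 0"
  then have pos: "norm (G y) > 0" by simp
  have "norm (G y) \<le> (2 + L) * (\<kappa> * norm (G y) powr q)"
    using residual_le_infdist[OF y] mult_left_mono[OF q, of "2 + L"] L_nonneg by linarith
  also have "norm (G y) powr q = norm (G y) powr (q - 1) * norm (G y)"
    using pos by (simp add: powr_diff)
  finally have "1 * norm (G y) \<le> ((2 + L) * \<kappa> * norm (G y) powr (q - 1)) * norm (G y)"
    by (simp add: mult_ac)
  then show False using small pos by (simp only: mult_le_cancel_right) simp
qed

text \<open>Optimality of \<open>p\<close> gives a subgradient of \<open>g\<close> there. Testing it
  at \<open>z\<close> yields the predicted decrease; pairing it with the subgradient at the proximal
  point \<open>z - G z\<close> yields the residual bound. The slack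
  \<open>\<eta> + c \<le> h\<close> absorbs the error term \<open>e \<bullet> d\<close> in
  both.\<close>

lemma inexact_newton_step:
  assumes z: "z \<in> effective_dom g"
    and lower: "\<And>v. h * (norm v)\<^sup>2 \<le> v \<bullet> (H *v v)" and upper: "\<And>v. norm (H *v v) \<le> M * norm v"
    and sym: "\<And>u v. u \<bullet> (H *v v) = v \<bullet> (H *v u)"
    and min: "is_arg_min (\<lambda>y. quad_model f g y z H + ereal (e \<bullet> (y - z))) (\<lambda>_. True) p"
    and e: "norm e \<le> \<eta> * norm (p - z)" and \<eta>: "0 \<le> \<eta>" "\<eta> + c \<le> h" "0 < c"
  shows "p \<in> effective_dom g"
    and "grad f z \<bullet> (p - z) + gr p - gr z \<le> - c * (norm (p - z))\<^sup>2"
    and "norm (G z) \<le> (1 + M + \<eta>) * norm (p - z)"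
proof -
  define d where "d = p - z"
  let ?h = "\<lambda>y. fr z + grad f z \<bullet> (y - z) + 1/2 * ((y - z) \<bullet> (H *v (y - z))) + e \<bullet> (y - z)"
  have "quad_model f g y z H + ereal (e \<bullet> (y - z)) = ereal (?h y) + g y" for y
    unfolding quad_model_def using f_real[of z] z dom_subset
    by (cases "f z"; cases "g y") auto
  note * = is_arg_min_effective_dom[OF proper z min, of ?h, OF this]
  show p: "p \<in> effective_dom g" by (rule *(1))
  have "(?h has_derivative (\<lambda>k. grad f z \<bullet> k + 1/2 * ((p - z) \<bullet> (H *v k) + k \<bullet> (H *v (p - z))) + e \<bullet> k)) (at p)"
    by (auto intro!: derivative_eq_intros bounded_linear.has_derivative[OF matrix_vector_mul_bounded_linear])
  then have "GDERIV ?h p :> grad f z + H *v d + e"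
    unfolding gderiv_def
    by (rule has_derivative_eq_rhs) (auto simp: sym[of d] d_def[symmetric] inner_add_right inner_commute)
  then have sub: "- (grad f z + H *v d + e) \<in> subdifferential g p"
    by (rule minimizer_imp_subgradient[OF proper convex p _ *(2)])
  have ed: "\<bar>e \<bullet> d\<bar> \<le> \<eta> * (norm d)\<^sup>2"
  proof -
    have "\<bar>e \<bullet> d\<bar> \<le> norm e * norm d" by (rule Cauchy_Schwarz_ineq2)
    also have "\<dots> \<le> (\<eta> * norm d) * norm d" using e by (intro mult_right_mono) (auto simp: d_def)
    finally show ?thesis by (simp add: power2_eq_square)
  qed
  have He: "c * (norm d)\<^sup>2 \<le> d \<bullet> (H *v d) + e \<bullet> d"
    using lower[of d] ed mult_right_mono[OF \<eta>(2), of "(norm d)\<^sup>2"] by (simp add: distrib_right)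
  have "gr p + (- (grad f z + H *v d + e)) \<bullet> (z - p) \<le> gr z"
    using sub z by (auto simp: subdifferential_iff[OF proper])
  then have "grad f z \<bullet> d + gr p - gr z \<le> - (d \<bullet> (H *v d) + e \<bullet> d)"
    by (simp add: d_def inner_simps inner_commute)
  then show "grad f z \<bullet> (p - z) + gr p - gr z \<le> - c * (norm (p - z))\<^sup>2"
    using He by (simp add: d_def)
  have "0 \<le> (G z - grad f z - - (grad f z + H *v d + e)) \<bullet> (z - G z - p)"
    by (rule subdifferential_monotone[OF proper subgradient_residual sub])
  also have "\<dots> = - (norm (G z))\<^sup>2 - G z \<bullet> (d + H *v d + e) - (d \<bullet> (H *v d) + e \<bullet> d)"
    by (simp add: d_def inner_simps inner_commute power2_norm_eq_inner)
  finally have "(norm (G z))\<^sup>2 \<le> - (G z \<bullet> (d + H *v d + e))"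
    using He \<eta>(3) by (smt (verit) mult_nonneg_nonneg zero_le_power2)
  also have "\<dots> \<le> norm (G z) * norm (d + H *v d + e)"
    using Cauchy_Schwarz_ineq2[of "G z" "d + H *v d + e"] by linarith
  also have "\<dots> \<le> norm (G z) * ((1 + M + \<eta>) * norm d)"
  proof (intro mult_left_mono)
    show "norm (d + H *v d + e) \<le> (1 + M + \<eta>) * norm d"
      using norm_triangle_ineq[of "d + H *v d" e] norm_triangle_ineq[of d "H *v d"] upper[of d] e
      by (simp add: d_def[symmetric] distrib_right)
  qed simp
  finally have le: "norm (G z) * norm (G z) \<le> norm (G z) * ((1 + M + \<eta>) * norm d)"
    by (simp add: power2_eq_square)
  \<comment> \<open>Cancelling \<open>norm (G z)\<close> requires it to be nonzero; nonnegativity of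
    the bound handles the other case.\<close>
  have "0 \<le> M * norm d" using upper[of d] norm_ge_zero order_trans by blast
  then have "0 \<le> (1 + M + \<eta>) * norm d" using \<eta>(1) by (simp add: distrib_right)
  then have "norm (G z) \<le> (1 + M + \<eta>) * norm d"
    using le by (cases "G z = 0") (auto simp: mult_le_cancel_left)
  then show "norm (G z) \<le> (1 + M + \<eta>) * norm (p - z)" by (simp add: d_def)
qed

text \<open>With \<open>t = \<theta>^j\<close>, convexity of \<open>g\<close> and the descent
  estimate change the objective by at most
  \<open>- t * (norm d)\<^sup>2 / 2 * (2 * c - t * L)\<close>, which suffices once the bracket is at
  least \<open>\<tau>\<close>.\<close>

lemma sufficient_decreaseI:
  assumes z: "z \<in> effective_dom g" and p: "p \<in> effective_dom g"
    and dec: "grad f z \<bullet> (p - z) + gr p - gr z \<le> - c * (norm (p - z))\<^sup>2"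
    and \<theta>: "0 < \<theta>" "\<theta> \<le> 1" and le: "\<theta>^j * L \<le> 2 * c - \<tau>"
  shows "sufficient_decrease (\<lambda>y. f y + g y) \<tau> \<theta> z (p - z) j"
proof -
  define t where "t = \<theta>^j"
  have t: "0 < t" "t \<le> 1" using \<theta> by (auto simp: t_def power_le_one)
  define d where "d = p - z"
  let ?w = "z + t *\<^sub>R d"
  have w: "?w \<in> effective_dom g" "gr ?w \<le> (1 - t) * gr z + t * gr p"
    using convex_fun_effective_dom[OF proper convex z p, of t] t by (auto simp: d_def)
  have "fr ?w \<le> fr z + t * (grad f z \<bullet> d) + L / 2 * (t * norm d)\<^sup>2"
    using descent[OF z w(1)] t by simp
  then have "fr ?w + gr ?w \<le> fr z + gr z + t * (grad f z \<bullet> d + gr p - gr z) + L / 2 * (t * norm d)\<^sup>2"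
    using w(2) by (simp add: algebra_simps)
  also have "\<dots> \<le> fr z + gr z + t * (- c * (norm d)\<^sup>2) + L / 2 * (t * norm d)\<^sup>2"
    using mult_left_mono[OF dec, of t] t by (simp add: d_def)
  also have "\<dots> = fr z + gr z - t * (norm d)\<^sup>2 / 2 * (2 * c - t * L)"
    by (simp add: power2_eq_square field_simps)
  also have "\<dots> \<le> fr z + gr z - t * (norm d)\<^sup>2 / 2 * \<tau>"
    using le t by (intro diff_left_mono mult_left_mono) (auto simp: t_def)
  finally have "fr ?w + gr ?w \<le> fr z + gr z - \<tau> / 2 * t * (norm d)\<^sup>2" by (simp add: mult_ac)
  then show ?thesis
    unfolding sufficient_decrease_def d_def[symmetric] t_def[symmetric]
    by (simp add: objective_real z w(1))
qed

end

theorem theorem2: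
  fixes f g :: "real^'n \<Rightarrow> ereal"
    and \<Omega>\<^sub>2 :: "(real^'n) set"
    and x :: "nat \<Rightarrow> real^'n"
    and L\<^sub>H L\<^sub>C \<epsilon>\<^sub>0 c \<tau> \<mu>\<^sub>1 \<mu>\<^sub>2 \<delta> \<theta> q :: real
  assumes solution_exists: "\<exists>z. \<forall>y. f z + g z \<le> f y + g y"
    \<comment> \<open>assumption (i)\<close>
    and f_gt_minf: "\<forall>y. f y \<noteq> -\<infinity>"
    and \<Omega>\<^sub>2: "open \<Omega>\<^sub>2" "effective_dom g \<subseteq> \<Omega>\<^sub>2"
    and f_C2: "twice_cont_diff_on \<Omega>\<^sub>2 f"
    and grad_lipschitz: "L\<^sub>H-lipschitz_on \<Omega>\<^sub>2 (grad f)"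
    and \<epsilon>\<^sub>0: "\<epsilon>\<^sub>0 > 0"
    and hess_lipschitz:
      "\<forall>y \<in> (\<Union>z\<in>cluster_points x. ball z \<epsilon>\<^sub>0) \<inter> \<Omega>\<^sub>2.
       \<forall>y' \<in> (\<Union>z\<in>cluster_points x. ball z \<epsilon>\<^sub>0) \<inter> \<Omega>\<^sub>2.
         spectral_norm (hess f y - hess f y') \<le> L\<^sub>C * norm (y - y')"
    \<comment> \<open>assumption (ii)\<close>
    and g: "proper_fun g" "closed_fun g" "convex_fun g" "continuous_on (effective_dom g) g"
    \<comment> \<open>assumption (iii)\<close>
    and level_bounded: "\<forall>y\<in>effective_dom g. bounded {z. f z + g z \<le> f y + g y}"
    \<comment> \<open>parameters and iterates of the algorithm\<close>
    and c: "c > 0" "c > \<mu>\<^sub>2 * (1 + 2 * L\<^sub>H + \<mu>\<^sub>1) / (2 - \<mu>\<^sub>2)"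
    and \<tau>: "\<tau> \<in> {0<..<c}"
    and \<mu>: "\<mu>\<^sub>1 \<in> {0<..1}" "\<mu>\<^sub>2 \<in> {0<..\<mu>\<^sub>1}"
    and \<delta>: "\<delta> \<in> {0..1}"
    and \<theta>: "\<theta> \<in> {0<..<1}"
    and x0: "x 0 \<in> effective_dom g"
    and x: "ipn_sequence f g \<tau> \<mu>\<^sub>2 \<delta> \<theta> (\<lambda>k. reg_hessian f g c \<mu>\<^sub>1 \<delta> (x k)) x"
    and q: "q > 1"
    and subregular: "\<forall>z\<in>cluster_points x. metric_q_subregular_at \<Omega>\<^sub>2 f g q z"
  shows "\<forall>z\<in>cluster_points x. converges_with_order x z q"
proof
  fix z assume z: "z \<in> cluster_points x"
  interpret composite_problem f g \<Omega>\<^sub>2 L\<^sub>H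
  proof
    \<comment> \<open>The objective at \<open>x 0\<close> is below infinity; comparison with it puts
      the global minimizer into \<open>effective_dom g\<close>.\<close>
    obtain z where min: "\<And>y. f z + g z \<le> f y + g y" using solution_exists by blast
    have "x 0 \<in> \<Omega>\<^sub>2" using x0 \<Omega>\<^sub>2(2) by blast
    then have "\<bar>f (x 0)\<bar> \<noteq> \<infinity>" using f_C2 by (simp add: twice_cont_diff_on_def)
    then have "f (x 0) + g (x 0) < \<infinity>" using x0 by (auto simp: effective_dom_def)
    then have "f z + g z < \<infinity>" using min le_less_trans by blast
    then have "z \<in> effective_dom g"
      using f_gt_minf by (auto simp: effective_dom_def)
    then show "\<exists>z\<in>effective_dom g. \<forall>y\<in>effective_dom g. f z + g z \<le> f y + g y"
      using min by blast
  qed (use \<Omega>\<^sub>2 f_C2 grad_lipschitz g in auto)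
  define H where "H = (\<lambda>k. reg_hessian f g c \<mu>\<^sub>1 \<delta> (x k))"
  define m where "m k = min 1 (pow0 (norm (G (x k))) \<delta>)" for k
  have m: "0 \<le> m k" "m k \<le> 1" for k by (auto simp: m_def pow0_def)
  obtain xhat err j where
    argmin: "\<And>k. is_arg_min (\<lambda>y. quad_model f g y (x k) (H k) + ereal (err k \<bullet> (y - x k))) (\<lambda>_. True) (xhat k)"
    and err: "\<And>k. norm (err k) \<le> \<mu>\<^sub>2 / 2 * m k * norm (xhat k - x k)"
    and decrease: "\<And>k. sufficient_decrease (\<lambda>y. f y + g y) \<tau> \<theta> (x k) (xhat k - x k) (j k)"
    and first: "\<And>k i. i < j k \<Longrightarrow> \<not> sufficient_decrease (\<lambda>y. f y + g y) \<tau> \<theta> (x k) (xhat k - x k) i"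
    and step: "\<And>k. x (Suc k) = x k + \<theta>^(j k) *\<^sub>R (xhat k - x k)"
    using x unfolding ipn_sequence_def H_def m_def by blast
  \<comment> \<open>The residual bound of \<open>inexact_newton_step\<close>, with
    \<open>m k\<close> replaced by 1 to make it uniform in \<open>k\<close>.\<close>
  define N where "N = 1 + (2 * L\<^sub>H + c + \<mu>\<^sub>1) + \<mu>\<^sub>2 / 2"
  have step_bounds:
    "xhat k \<in> effective_dom g"
    "grad f (x k) \<bullet> (xhat k - x k) + gr (xhat k) - gr (x k) \<le> - c * (norm (xhat k - x k))\<^sup>2"
    "norm (G (x k)) \<le> N * norm (xhat k - x k)"
    if k: "x k \<in> effective_dom g" for k
  proof -
    have in\<Omega>: "x k \<in> \<Omega>\<^sub>2" using k \<Omega>\<^sub>2(2) by blast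
    have pos: "0 < c" "0 < \<mu>\<^sub>1" "0 \<le> \<mu>\<^sub>2 / 2 * m k" using c \<mu> m by auto
    \<comment> \<open>Here \<open>\<mu>\<^sub>2 \<le> \<mu>\<^sub>1\<close> pays for the
      inexactness: error and regularization scale with the same \<open>m k\<close>.\<close>
    have "\<mu>\<^sub>2 / 2 * m k \<le> \<mu>\<^sub>1 * m k" using \<mu> m by (intro mult_right_mono) auto
    then have le: "\<mu>\<^sub>2 / 2 * m k + c \<le> c + \<mu>\<^sub>1 * m k" by simp
    note bounds = reg_hessian_bounds[OF in\<Omega> pos(1,2), where \<delta> = \<delta>, folded m_def]
    note * = inexact_newton_step[OF k bounds reg_hessian_symmetric[OF in\<Omega>]
        argmin[unfolded H_def] err pos(3) le pos(1)]
    show "xhat k \<in> effective_dom g"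
      "grad f (x k) \<bullet> (xhat k - x k) + gr (xhat k) - gr (x k) \<le> - c * (norm (xhat k - x k))\<^sup>2"
      by (fact *(1,2))+
    have "\<mu>\<^sub>2 / 2 * m k \<le> \<mu>\<^sub>2 / 2 * 1" using \<mu> m by (intro mult_left_mono) auto
    then have "(1 + (2 * L\<^sub>H + c + \<mu>\<^sub>1) + \<mu>\<^sub>2 / 2 * m k) * norm (xhat k - x k) \<le> N * norm (xhat k - x k)"
      by (intro mult_right_mono) (auto simp: N_def)
    with *(3) show "norm (G (x k)) \<le> N * norm (xhat k - x k)" by linarith
  qed
  have \<theta>pow: "0 < \<theta>^i" "\<theta>^i \<le> 1" for i using \<theta> by (auto simp: power_le_one)
  have xdom: "x k \<in> effective_dom g" for k
  proof (induction k)
    case (Suc k)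
    show ?case
      unfolding step
      using convex_fun_effective_dom(1)[OF proper convex Suc step_bounds(1)[OF Suc]] \<theta>pow[of "j k"]
      by simp
  qed (rule x0)

  \<comment> \<open>If \<open>j k = Suc i\<close>, exponent \<open>i\<close> was rejected, so
    \<open>\<theta>^i * L\<^sub>H > 2 * c - \<tau> > c\<close>; one more factor
    \<open>\<theta>\<close> gives the bound. The 1 in \<open>L\<^sub>H + 1\<close> avoids division
    by 0, and \<open>min 1\<close> covers \<open>j k = 0\<close>.\<close>
  define a where "a = min 1 (\<theta> * c / (L\<^sub>H + 1))"
  have a: "0 < a" using \<theta> c L_nonneg by (simp add: a_def)
  have step_size: "a \<le> \<theta>^(j k)" for k
  proof (cases "j k")
    case (Suc i)
    have "\<not> \<theta>^i * L\<^sub>H \<le> 2 * c - \<tau>"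
      using sufficient_decreaseI[OF xdom[of k] step_bounds(1,2)[OF xdom[of k]], of \<theta> i \<tau>]
        first[of i k] Suc \<theta> by auto
    then have "c \<le> \<theta>^i * (L\<^sub>H + 1)" using \<tau> \<theta>pow[of i] by (auto simp: distrib_left)
    then have "\<theta> * c \<le> \<theta> * (\<theta>^i * (L\<^sub>H + 1))" using \<theta> by simp
    then have "\<theta> * c / (L\<^sub>H + 1) \<le> \<theta>^(j k)" using L_nonneg by (simp add: Suc field_simps)
    then show ?thesis by (simp add: a_def)
  qed (simp add: a_def)

  \<comment> \<open>Convergence of the objective values and vanishing of the residual\<close>
  define P where "P k = fr (x k) + gr (x k)" for k
  have P_dec: "\<tau> / 2 * a * (norm (xhat k - x k))\<^sup>2 \<le> P k - P (Suc k)" for k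
  proof -
    have "\<tau> / 2 * a * (norm (xhat k - x k))\<^sup>2 \<le> \<tau> / 2 * \<theta>^(j k) * (norm (xhat k - x k))\<^sup>2"
      using \<tau> step_size by (intro mult_right_mono mult_left_mono) auto
    moreover have "P (Suc k) \<le> P k - \<tau> / 2 * \<theta>^(j k) * (norm (xhat k - x k))\<^sup>2"
      using decrease[of k] unfolding sufficient_decrease_def step[symmetric] P_def
      by (simp add: objective_real xdom)
    ultimately show ?thesis by linarith
  qed
  have "decseq P"
  proof (rule decseq_SucI)
    fix k show "P (Suc k) \<le> P k"
      using order_trans[OF _ P_dec[of k], of 0] \<tau> a by simp
  qed
  moreover have "\<exists>b. \<forall>k. b \<le> P k"
  proof -
    obtain w where "w \<in> effective_dom g" "\<And>y. y \<in> effective_dom g \<Longrightarrow> f w + g w \<le> f y + g y"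
      using solvable by blast
    then have "fr w + gr w \<le> P k" for k
      using xdom[of k] unfolding P_def by (metis ereal_less_eq(3) objective_real)
    then show ?thesis by blast
  qed
  ultimately obtain l where P: "P \<longlonglongrightarrow> l" by (metis decseq_convergent)
  have "(\<lambda>k. P k - P (Suc k)) \<longlonglongrightarrow> 0" using tendsto_diff[OF P LIMSEQ_Suc[OF P]] by simp
  then have lim: "(\<lambda>k. N\<^sup>2 / (\<tau> / 2 * a) * (P k - P (Suc k))) \<longlonglongrightarrow> 0"
    by (rule tendsto_mult_right_zero)
  have upper: "(norm (G (x k)))\<^sup>2 \<le> N\<^sup>2 / (\<tau> / 2 * a) * (P k - P (Suc k))" for k
  proof -
    have "(norm (G (x k)))\<^sup>2 \<le> (N * norm (xhat k - x k))\<^sup>2"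
      by (intro power_mono step_bounds(3) xdom norm_ge_zero)
    also have "\<dots> = N\<^sup>2 / (\<tau> / 2 * a) * (\<tau> / 2 * a * (norm (xhat k - x k))\<^sup>2)"
      using \<tau> a by (simp add: power_mult_distrib)
    also have "\<dots> \<le> N\<^sup>2 / (\<tau> / 2 * a) * (P k - P (Suc k))"
      using \<tau> a by (intro mult_left_mono P_dec) simp
    finally show ?thesis .
  qed
  have "(\<lambda>k. (norm (G (x k)))\<^sup>2) \<longlonglongrightarrow> 0"
    by (rule tendsto_sandwich[OF always_eventually always_eventually tendsto_const lim])
      (intro allI upper zero_le_power2)+
  then have "(\<lambda>k. sqrt ((norm (G (x k)))\<^sup>2)) \<longlonglongrightarrow> sqrt 0"
    by (rule tendsto_real_sqrt)
  then have G_lim: "(\<lambda>k. norm (G (x k))) \<longlonglongrightarrow> 0" by simp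

  \<comment> \<open>A stationary iterate near the cluster point, and the constant tail\<close>
  obtain r where r: "strict_mono r" "(x \<circ> r) \<longlonglongrightarrow> z" using z by (auto simp: cluster_points_def)
  obtain \<epsilon> \<kappa> where \<epsilon>: "\<epsilon> > 0"
    and subreg: "\<And>y. y \<in> ball z \<epsilon> \<Longrightarrow> infdist y (stationary_points f g) \<le> \<kappa> * norm (G y) powr q"
    using subregular z unfolding metric_q_subregular_at_def by blast
  \<comment> \<open>Since \<open>q - 1 > 0\<close>, the power is continuous at 0 and the limit is
    0.\<close>
  have "(\<lambda>k. (2 + L\<^sub>H) * \<kappa> * norm (G (x k)) powr (q - 1)) \<longlonglongrightarrow> (2 + L\<^sub>H) * \<kappa> * 0 powr (q - 1)"
    using q by (intro tendsto_mult_left tendsto_powr' G_lim tendsto_const) simp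
  then have "\<forall>\<^sub>F k in sequentially. (2 + L\<^sub>H) * \<kappa> * norm (G (x k)) powr (q - 1) < 1"
    by (rule order_tendstoD) simp
  then have "\<forall>\<^sub>F k in sequentially. (2 + L\<^sub>H) * \<kappa> * norm (G (x (r k))) powr (q - 1) < 1"
    using r(1) by (rule eventually_subseq[rotated])
  moreover have "\<forall>\<^sub>F k in sequentially. x (r k) \<in> ball z \<epsilon>"
    using topological_tendstoD[OF r(2) open_ball, of z \<epsilon>] \<epsilon> by simp
  ultimately have "\<forall>\<^sub>F k in sequentially. G (x (r k)) = 0"
  proof eventually_elim
    case (elim k)
    show ?case
      by (rule residual_eq_0_if_small[OF _ subreg[OF elim(2)] elim(1)]) (use xdom \<Omega>\<^sub>2(2) in blast)
  qed
  then obtain K where K: "G (x K) = 0" by (auto simp: eventually_sequentially)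
  have stay: "x (Suc k) = x k" if "G (x k) = 0" for k
  proof -
    \<comment> \<open>Stationarity makes the predicted change along the step nonnegative, whereas
      \<open>step_bounds(2)\<close> puts it below \<open>- c\<close> times the squared step length;
      the step is therefore 0 whatever admissible error vector is chosen.\<close>
    have "- grad f (x k) \<in> subdifferential g (x k)"
      using that residual_eq_0_iff stationary_points_iff by blast
    then have "gr (x k) + (- grad f (x k)) \<bullet> (xhat k - x k) \<le> gr (xhat k)"
      using step_bounds(1)[OF xdom] by (auto simp: subdifferential_iff[OF proper])
    then have "c * (norm (xhat k - x k))\<^sup>2 \<le> 0" using step_bounds(2)[OF xdom, of k] by simp
    then have "xhat k = x k" using c(1) by (simp add: mult_le_0_iff)
    then show ?thesis by (simp add: step)
  qed
  have const: "x k = x K" if "K \<le> k" for k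
    using that by (induction rule: dec_induct) (simp_all add: stay K)
  then have "\<forall>\<^sub>F k in sequentially. x k = x K" by (rule eventually_sequentiallyI)
  then have lim: "x \<longlonglongrightarrow> x K" by (rule tendsto_eventually)
  then have "(x \<circ> r) \<longlonglongrightarrow> x K" using r(1) by (rule LIMSEQ_subseq_LIMSEQ)
  then have xK: "x K = z" using r(2) LIMSEQ_unique by blast
  \<comment> \<open>Both sides vanish, \<open>0 powr q\<close> being 0, so the constant 1 is an
    arbitrary choice.\<close>
  have "norm (x (Suc k) - z) \<le> 1 * norm (x k - z) powr q" if "K \<le> k" for k
    unfolding const[OF that] const[OF le_SucI[OF that]] xK by simp
  then have "\<forall>\<^sub>F k in sequentially. norm (x (Suc k) - z) \<le> 1 * norm (x k - z) powr q"
    by (rule eventually_sequentiallyI)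
  then show "converges_with_order x z q"
    using lim unfolding converges_with_order_def xK by blast
qed

end
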